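(* There are dynamical systems that are transitive compact but not totally transitive.
   Context: A dynamical system $(X,T)$ consists of a nonempty compact metric space $X$ and a continuous surjective map $T:X\to X$; by standing assumption $X$ has no isolated points and is not a singleton. $\mathbb{Z}_+$ is the set of nonnegative integers. "Opene" means open and nonempty. For opene $U,V\subset X$ put $N_T(U,V)=\{n\in\mathbb{Z}_+: U\cap T^{-n}V\neq\varnothing\}$, and for $x\in X$, $G\subset X$ put $N_T(x,G)=\{n\in\mathbb{Z}_+: T^nx\in G\}$. The system is transitive if $N_T(U,V)\neq\varnothing$ for all opene $U,V\subset X$, and totally transitive if $(X,T^k)$ is transitive for every integer $k\ge1$. The system is transitive compact if for every $x\in X$ there is $z\in X$ such that $N_T(x,G)\cap N_T(U,V)\neq\varnothing$ for every neighborhood $G$ of $z$ and all opene $U,V\subset X$. *)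

theory Defs
  imports "HOL-Analysis.Analysis"
begin

text \<open>
  A system is given by a bundled metric space \<open>m\<close> (with carrier \<open>mspace m\<close>) and a map
  \<open>T\<close> on the ambient type; the values of \<open>T\<close> outside \<open>mspace m\<close> are irrelevant.
  The last two conjuncts are the standing assumption (no isolated points, not a singleton).
\<close>

definition dynamical_system :: "'a metric \<Rightarrow> ('a \<Rightarrow> 'a) \<Rightarrow> bool" where
  "dynamical_system m T \<longleftrightarrow>
     mspace m \<noteq> {} \<and>
     compact_space (mtopology_of m) \<and>
     continuous_map (mtopology_of m) (mtopology_of m) T \<and>
     T ` mspace m = mspace m \<and>
     (\<forall>x\<in>mspace m. \<not> openin (mtopology_of m) {x}) \<and>
     \<not> (\<exists>x. mspace m = {x})"

definition opene :: "'a metric \<Rightarrow> 'a set \<Rightarrow> bool" where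
  "opene m U \<longleftrightarrow> openin (mtopology_of m) U \<and> U \<noteq> {}"

definition neighborhood_of :: "'a metric \<Rightarrow> 'a \<Rightarrow> 'a set \<Rightarrow> bool" where
  "neighborhood_of m z G \<longleftrightarrow>
     G \<subseteq> mspace m \<and> (\<exists>W. openin (mtopology_of m) W \<and> z \<in> W \<and> W \<subseteq> G)"

text \<open>
  The preimage below is taken in the ambient type; for \<open>U \<subseteq> mspace m\<close> intersecting with \<open>U\<close>
  makes this the same as taking it in the space.
\<close>

definition hitting_times :: "('a \<Rightarrow> 'a) \<Rightarrow> 'a set \<Rightarrow> 'a set \<Rightarrow> nat set" where
  "hitting_times T U V = {n. U \<inter> (T ^^ n) -` V \<noteq> {}}"

definition visiting_times :: "('a \<Rightarrow> 'a) \<Rightarrow> 'a \<Rightarrow> 'a set \<Rightarrow> nat set" where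
  "visiting_times T x G = {n. (T ^^ n) x \<in> G}"

definition transitive_system :: "'a metric \<Rightarrow> ('a \<Rightarrow> 'a) \<Rightarrow> bool" where
  "transitive_system m T \<longleftrightarrow>
     (\<forall>U V. opene m U \<longrightarrow> opene m V \<longrightarrow> hitting_times T U V \<noteq> {})"

definition totally_transitive :: "'a metric \<Rightarrow> ('a \<Rightarrow> 'a) \<Rightarrow> bool" where
  "totally_transitive m T \<longleftrightarrow> (\<forall>k\<ge>1. transitive_system m (T ^^ k))"

definition transitive_compact :: "'a metric \<Rightarrow> ('a \<Rightarrow> 'a) \<Rightarrow> bool" where
  "transitive_compact m T \<longleftrightarrow>
     (\<forall>x\<in>mspace m. \<exists>z\<in>mspace m. \<forall>G U V.
        neighborhood_of m z G \<longrightarrow> opene m U \<longrightarrow> opene m V \<longrightarrow>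
        visiting_times T x G \<inter> hitting_times T U V \<noteq> {})"

text \<open>
  HOL cannot quantify existentially over types, so an existence claim about systems has to name
  the type the points live in. The type \<open>nat \<Rightarrow> real\<close> loses no generality: it has the cardinality
  of the continuum, no compact metric space has more points, and both the carrier and the metric
  of an \<open>(nat \<Rightarrow> real) metric\<close> are arbitrary. Hence every system is isometrically conjugate to one
  whose points lie in this type.
\<close>

type_synonym point = "nat \<Rightarrow> real"

end

theory Submission
  imports Defs
begin

text \<open>
  The example is a spacing shift: the one-sided shift on all 0-1 sequences in which the distance
  of any two ones belongs to a prescribed set \<open>P\<close>. Here \<open>P\<close> consists of the even numbers that
  are not a difference of two powers of 3. Three properties of \<open>P\<close> carry the proof.

  \<^item> All elements of \<open>P\<close> are even, so the ones of a sequence are all at even or all at odd positions,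
    and even powers of the shift preserve their parity. Hence the square of the shift is not
    transitive.

  \<^item> \<open>P\<close> contains all even numbers strictly between \<open>3 ^ m\<close> and \<open>2 * 3 ^ m\<close>. Any two words
    of the shift, read at a distance well inside such a long interval and of the right parity, fit
    into one sequence. So a set of hitting times contains all numbers of one parity class in
    arbitrarily long intervals (\<open>hitting_times_in_long_intervals\<close>).

  \<^item> \<open>P\<close> misses the differences of powers of 3. By the pigeonhole principle every
    sequence of the shift therefore has blocks of zeros of every given length, with bounded gaps
    between them (\<open>zero_block\<close>). So the times at which an orbit is close to the zero sequence meet
    every long interval, and since a block of zeros can be lengthened by one, they do so in
    either parity class.

  Together, the last two properties make the zero sequence a limit point, common to all \<open>x\<close>, of the
  kind that transitive compactness asks for. The two parity classes of sequences meet in the zero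
  sequence only; it is this meeting point that lets the parity obstruction for the square coexist
  with transitive compactness.
\<close>

section \<open>Spacing shifts\<close>

definition shift :: "point \<Rightarrow> point" where
  "shift x = (\<lambda>n. x (Suc n))"

definition spacing_shift :: "nat set \<Rightarrow> point set" where
  "spacing_shift P = {x. (\<forall>n. x n \<in> {0, 1}) \<and>
     (\<forall>i j. i < j \<longrightarrow> x i \<noteq> 0 \<longrightarrow> x j \<noteq> 0 \<longrightarrow> j - i \<in> P)}"

definition spacing_metric :: "nat set \<Rightarrow> point metric" where
  "spacing_metric P = submetric euclidean_metric (spacing_shift P)"

lemma mspace_spacing_metric [simp]: "mspace (spacing_metric P) = spacing_shift P"
  by (simp add: spacing_metric_def)

lemma mtopology_spacing_metric [simp]:
  "mtopology_of (spacing_metric P) = top_of_set (spacing_shift P)"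
  by (simp add: spacing_metric_def mtopology_of_submetric)

lemma funpow_shift: "(shift ^^ n) x = (\<lambda>k. x (n + k))"
  by (induction n arbitrary: x) (simp_all add: shift_def funpow_Suc_right del: funpow.simps)

lemma zero_in_spacing_shift: "(\<lambda>_. 0) \<in> spacing_shift P"
  by (simp add: spacing_shift_def)

lemma single_one_in_spacing_shift: "(\<lambda>k. if k = n then 1 else 0) \<in> spacing_shift P"
  by (auto simp: spacing_shift_def)

lemma spacing_shiftD:
  "\<lbrakk>x \<in> spacing_shift P; i < j; x i \<noteq> 0; x j \<noteq> 0\<rbrakk> \<Longrightarrow> j - i \<in> P"
  by (simp add: spacing_shift_def)

lemma funpow_shift_in_spacing_shift:
  assumes "x \<in> spacing_shift P"
  shows "(shift ^^ n) x \<in> spacing_shift P"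
proof -
  have "j - i \<in> P" if "i < j" "x (n + i) \<noteq> 0" "x (n + j) \<noteq> 0" for i j
    using spacing_shiftD[OF assms, of "n + i" "n + j"] that by simp
  then show ?thesis
    using assms by (simp add: funpow_shift spacing_shift_def)
qed

lemma shift_image_spacing_shift: "shift ` spacing_shift P = spacing_shift P"
proof
  show "shift ` spacing_shift P \<subseteq> spacing_shift P"
    using funpow_shift_in_spacing_shift[where n = 1] by auto
  show "spacing_shift P \<subseteq> shift ` spacing_shift P"
  proof
    fix x assume x: "x \<in> spacing_shift P"
    \<comment> \<open>Prepending a zero creates no new distances between ones.\<close>
    let ?y = "case_nat 0 x :: point"
    have "?y \<in> spacing_shift P"
      using x by (auto simp: spacing_shift_def split: nat.splits)
    moreover have "shift ?y = x"
      by (simp add: shift_def)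
    ultimately show "x \<in> shift ` spacing_shift P"
      by (metis imageI)
  qed
qed

lemma closed_spacing_shift: "closed (spacing_shift P)"
proof -
  have "spacing_shift P = {x. (\<forall>n. x n = 0 \<or> x n = 1) \<and>
      (\<forall>i j. (i < j \<longrightarrow> j - i \<in> P) \<or> x i = 0 \<or> x j = 0)}"
    by (auto simp: spacing_shift_def)
  also have "closed \<dots>"
    by (intro closed_Collect_conj closed_Collect_all closed_Collect_disj closed_Collect_const
        closed_Collect_eq continuous_on_product_coordinates continuous_on_const)
  finally show ?thesis .
qed

lemma compact_spacing_shift: "compact (spacing_shift P)"
proof -
  have "compactin (product_topology (\<lambda>_. euclidean) UNIV) (\<Pi>\<^sub>E n\<in>(UNIV::nat set). {0, 1::real})"
    by (simp add: compactin_PiE)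
  then have "compact (\<Pi>\<^sub>E n\<in>(UNIV::nat set). {0, 1::real})"
    by (simp add: euclidean_product_topology)
  then have "compact ((\<Pi>\<^sub>E n\<in>(UNIV::nat set). {0, 1::real}) \<inter> spacing_shift P)"
    using closed_spacing_shift by (rule compact_Int_closed)
  also have "(\<Pi>\<^sub>E n\<in>(UNIV::nat set). {0, 1::real}) \<inter> spacing_shift P = spacing_shift P"
    by (auto simp: spacing_shift_def)
  finally show ?thesis .
qed

lemma continuous_on_shift: "continuous_on S shift"
  unfolding shift_def
  by (intro continuous_on_coordinatewise_then_product
      continuous_on_subset[OF continuous_on_product_coordinates]) simp

text \<open>
  Only finitely many coordinates are constrained by a basic open set of the product topology.
\<close>
lemma open_contains_cylinder:
  assumes "openin (top_of_set (spacing_shift P)) U" and "x \<in> U"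
  obtains L where "\<And>y. \<lbrakk>y \<in> spacing_shift P; \<And>i. i < L \<Longrightarrow> y i = x i\<rbrakk> \<Longrightarrow> y \<in> U"
proof -
  obtain W where W: "open W" "U = spacing_shift P \<inter> W"
    using assms(1) by (auto simp: openin_open)
  then have "openin (product_topology (\<lambda>_::nat. euclidean) UNIV) W" and "x \<in> W"
    using assms(2) by (auto simp: euclidean_product_topology)
  then obtain B where B: "x \<in> (\<Pi>\<^sub>E i\<in>UNIV. B i)" "finite {i. B i \<noteq> (UNIV::real set)}"
      "(\<Pi>\<^sub>E i\<in>UNIV. B i) \<subseteq> W"
    using product_topology_open_contains_basis[of "\<lambda>_. euclidean" UNIV W x] by auto
  obtain L where L: "\<And>i. B i \<noteq> UNIV \<Longrightarrow> i < L"
    using B(2) by (auto simp: finite_nat_set_iff_bounded)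
  show ?thesis
  proof
    fix y assume y: "y \<in> spacing_shift P" "\<And>i. i < L \<Longrightarrow> y i = x i"
    have "y i \<in> B i" for i
      using y(2)[of i] L[of i] B(1) by (cases "B i = UNIV") (auto simp: PiE_iff)
    then show "y \<in> U"
      using y(1) B(3) W(2) by (auto simp: PiE_iff)
  qed
qed

lemma openin_nonzero_coordinate:
  "openin (top_of_set (spacing_shift P)) {x \<in> spacing_shift P. x n \<noteq> 0}"
proof -
  have "open {x :: point. x n \<noteq> 0}"
    by (intro open_Collect_neq continuous_on_product_coordinates continuous_on_const)
  then show ?thesis
    by (auto simp: openin_open)
qed

text \<open>
  The alphabet contains 0, so the words can be padded by zeros; then only the distances between
  a one of the first word and a one of the second word matter.
\<close>
lemma join_words:
  assumes x: "x \<in> spacing_shift P" and y: "y \<in> spacing_shift P" and "L \<le> n"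
    and cross: "\<And>i j. \<lbrakk>i < L; j < L; x i \<noteq> 0; y j \<noteq> 0\<rbrakk> \<Longrightarrow> n + j - i \<in> P"
  obtains w where "w \<in> spacing_shift P" "\<And>i. i < L \<Longrightarrow> w i = x i" "\<And>j. j < L \<Longrightarrow> w (n + j) = y j"
proof
  define w :: point where
    "w k = (if k < L then x k else if n \<le> k \<and> k < n + L then y (k - n) else 0)" for k
  show "w i = x i" if "i < L" for i
    using that by (simp add: w_def)
  show "w (n + j) = y j" if "j < L" for j
    using that \<open>L \<le> n\<close> by (simp add: w_def)
  have "w k \<in> {0, 1}" for k
    using x y by (simp add: w_def spacing_shift_def)
  moreover have "j - i \<in> P" if ij: "i < j" "w i \<noteq> 0" "w j \<noteq> 0" for i j
  proof -
    have supp: "k < L \<or> n \<le> k \<and> k < n + L" if "w k \<noteq> 0" for k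
      using that by (auto simp: w_def split: if_splits)
    consider "j < L" | "i < L" "n \<le> j" "j < n + L" | "n \<le> i" "j < n + L"
      using supp[OF ij(2)] supp[OF ij(3)] by blast
    then show ?thesis
    proof cases
      case 1
      then show ?thesis
        using ij spacing_shiftD[OF x, of i j] by (simp add: w_def)
    next
      case 2
      then show ?thesis
        using ij cross[of i "j - n"] \<open>L \<le> n\<close> by (simp add: w_def)
    next
      case 3
      then have "y (i - n) \<noteq> 0" "y (j - n) \<noteq> 0"
        using ij \<open>L \<le> n\<close> by (simp_all add: w_def)
      then show ?thesis
        using ij(1) 3 spacing_shiftD[OF y, of "i - n" "j - n"] by simp
    qed
  qed
  ultimately show "w \<in> spacing_shift P"
    by (simp add: spacing_shift_def)
qed

section \<open>Even spacings that avoid differences of powers of 3\<close>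

definition spacings :: "nat set" where
  "spacings = {d. even d \<and> (\<forall>i j. d + 3 ^ i \<noteq> 3 ^ j)}"

text \<open>
  A difference \<open>3 ^ j - 3 ^ i\<close> with \<open>i < j\<close> is at least \<open>2 * 3 ^ (j - 1)\<close> and less than \<open>3 ^ j\<close>, so it
  is too small if \<open>j \<le> m\<close> and too large if \<open>m < j\<close>.
\<close>
lemma even_in_spacings:
  assumes "even d" and "3 ^ m < d" and "d < 2 * 3 ^ m"
  shows "d \<in> spacings"
proof -
  have "d + 3 ^ i \<noteq> 3 ^ j" for i j
  proof
    assume eq: "d + 3 ^ i = 3 ^ j"
    show False
    proof (cases "j \<le> m")
      case True
      then have "(3::nat) ^ j \<le> 3 ^ m"
        by (simp add: power_increasing)
      then show False
        using eq assms(2) by linarith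
    next
      case False
      then obtain j' where j': "j = Suc j'" "m \<le> j'"
        by (metis not_less_eq_eq Suc_le_D Suc_le_mono)
      have "(3::nat) ^ i < 3 ^ j"
        using eq assms(2) by linarith
      then have "i \<le> j'"
        using j'(1) power_less_imp_less_exp[of "3::nat" i j] by simp
      then have "(3::nat) ^ i \<le> 3 ^ j'" "(3::nat) ^ m \<le> 3 ^ j'"
        using j' by (simp_all add: power_increasing)
      then show False
        using eq assms(3) unfolding j'(1) power_Suc by linarith
    qed
  qed
  then show ?thesis
    using assms(1) by (simp add: spacings_def)
qed

lemma ones_have_same_parity:
  assumes "x \<in> spacing_shift spacings"
  obtains c where "\<And>i. x i \<noteq> 0 \<Longrightarrow> even (i + c)"
proof (cases "\<exists>c. x c \<noteq> 0")
  case True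
  then obtain c where c: "x c \<noteq> 0" by blast
  have "even (i + c)" if "x i \<noteq> 0" for i
    using spacing_shiftD[OF assms, of i c] spacing_shiftD[OF assms, of c i] c that
    by (cases i c rule: linorder_cases) (auto simp: spacings_def)
  then show ?thesis
    using that by blast
next
  case False
  then show ?thesis
    using that[of 0] by blast
qed

lemma hitting_times_in_long_intervals:
  assumes "opene (spacing_metric spacings) U" and "opene (spacing_metric spacings) V"
  obtains L c where "\<And>m n. \<lbrakk>3 ^ m + L < n; n + L \<le> 2 * 3 ^ m; even (n + c)\<rbrakk>
    \<Longrightarrow> n \<in> hitting_times shift U V"
proof -
  obtain x y where xU: "x \<in> U" and yV: "y \<in> V"
    using assms by (auto simp: opene_def)
  have op: "openin (top_of_set (spacing_shift spacings)) U"
    "openin (top_of_set (spacing_shift spacings)) V"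
    using assms by (auto simp: opene_def)
  then have x: "x \<in> spacing_shift spacings" and y: "y \<in> spacing_shift spacings"
    using xU yV openin_imp_subset by blast+
  obtain L1 where L1: "\<And>w. \<lbrakk>w \<in> spacing_shift spacings; \<And>i. i < L1 \<Longrightarrow> w i = x i\<rbrakk> \<Longrightarrow> w \<in> U"
    using open_contains_cylinder[OF op(1) xU] by blast
  obtain L2 where L2: "\<And>w. \<lbrakk>w \<in> spacing_shift spacings; \<And>i. i < L2 \<Longrightarrow> w i = y i\<rbrakk> \<Longrightarrow> w \<in> V"
    using open_contains_cylinder[OF op(2) yV] by blast
  obtain a where a: "\<And>i. x i \<noteq> 0 \<Longrightarrow> even (i + a)"
    using ones_have_same_parity[OF x] by blast
  obtain b where b: "\<And>i. y i \<noteq> 0 \<Longrightarrow> even (i + b)"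
    using ones_have_same_parity[OF y] by blast
  define L where "L = max L1 L2"
  show ?thesis
  proof
    fix m n
    assume n: "3 ^ m + L < n" "n + L \<le> 2 * 3 ^ m" "even (n + (a + b))"
    have "n + j - i \<in> spacings" if "i < L" "j < L" "x i \<noteq> 0" "y j \<noteq> 0" for i j
    proof (rule even_in_spacings)
      show "even (n + j - i)"
        using a[OF that(3)] b[OF that(4)] n(1,3) that(1) by (auto simp: even_diff_nat)
      show "3 ^ m < n + j - i" "n + j - i < 2 * 3 ^ m"
        using n(1,2) that(1,2) by linarith+
    qed
    moreover have "L \<le> n"
      using n(1) by linarith
    ultimately obtain w where w: "w \<in> spacing_shift spacings"
      "\<And>i. i < L \<Longrightarrow> w i = x i" "\<And>j. j < L \<Longrightarrow> w (n + j) = y j"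
      using join_words[OF x y] by metis
    have "w \<in> U"
      using L1 w by (simp add: L_def)
    moreover have "(shift ^^ n) w \<in> V"
      using L2 w funpow_shift_in_spacing_shift[OF w(1)] by (simp add: L_def funpow_shift)
    ultimately show "n \<in> hitting_times shift U V"
      by (auto simp: hitting_times_def)
  qed
qed

text \<open>
  If each of the \<open>k + 1\<close> windows of length \<open>k\<close> starting at \<open>a + 3 ^ i\<close> contained a one, then in two
  of them there would be a one at the same offset, and the distance of these two ones would be
  a difference of powers of 3.
\<close>
lemma zero_block:
  assumes x: "x \<in> spacing_shift spacings"
  obtains i where "i \<le> k" "\<And>p. p < k \<Longrightarrow> x (a + 3 ^ i + p) = 0"
proof -
  have "\<exists>i\<le>k. \<forall>p<k. x (a + 3 ^ i + p) = 0"
  proof (rule ccontr)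
    assume "\<not> (\<exists>i\<le>k. \<forall>p<k. x (a + 3 ^ i + p) = 0)"
    then have "\<forall>i. \<exists>p. i \<le> k \<longrightarrow> p < k \<and> x (a + 3 ^ i + p) \<noteq> 0"
      by blast
    then obtain f where f: "\<And>i. i \<le> k \<Longrightarrow> f i < k \<and> x (a + 3 ^ i + f i) \<noteq> 0"
      by metis
    then have "f ` {..k} \<subseteq> {..<k}"
      by auto
    then have "card (f ` {..k}) < card {..k}"
      using card_mono[of "{..<k}" "f ` {..k}"] by simp
    then have "\<not> inj_on f {..k}"
      by (rule pigeonhole)
    then obtain i j where ij: "i \<le> k" "j \<le> k" "i < j" "f i = f j"
      unfolding inj_on_def by (metis atMost_iff linorder_neqE_nat)
    have less: "(3::nat) ^ i < 3 ^ j"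
      using ij(3) by simp
    then have "(a + 3 ^ j + f j) - (a + 3 ^ i + f i) \<in> spacings"
      using f[OF ij(1)] f[OF ij(2)] ij(4)
        spacing_shiftD[OF x, of "a + 3 ^ i + f i" "a + 3 ^ j + f j"] by simp
    then have "3 ^ j - 3 ^ i \<in> spacings"
      using ij(4) by simp
    then show False
      using less unfolding spacings_def by (auto dest: spec[of _ i])
  qed
  then show ?thesis
    using that by blast
qed

lemma less_power_3: "n < (3::nat) ^ n"
  by (induction n) auto

section \<open>The system\<close>

text \<open>
  If \<open>x\<close> were isolated, then \<open>x\<close> itself would have ones at all positions of one parity class in
  some long interval, but the distance \<open>2 = 3 ^ 1 - 3 ^ 0\<close> is forbidden.
\<close>
lemma spacing_shift_no_isolated_points:
  assumes x: "x \<in> spacing_shift spacings"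
  shows "\<not> openin (top_of_set (spacing_shift spacings)) {x}"
proof
  assume "openin (top_of_set (spacing_shift spacings)) {x}"
  then have "opene (spacing_metric spacings) {x}"
    by (simp add: opene_def)
  moreover have "opene (spacing_metric spacings) {y \<in> spacing_shift spacings. y 0 \<noteq> 0}"
    using openin_nonzero_coordinate single_one_in_spacing_shift[of 0 spacings]
    by (auto simp: opene_def)
  ultimately obtain L c where Lc: "\<And>m n. \<lbrakk>3 ^ m + L < n; n + L \<le> 2 * 3 ^ m; even (n + c)\<rbrakk>
      \<Longrightarrow> n \<in> hitting_times shift {x} {y \<in> spacing_shift spacings. y 0 \<noteq> 0}"
    using hitting_times_in_long_intervals by blast
  define m where "m = 2 * L + 4"
  have m: "2 * L + 4 < 3 ^ m"
    unfolding m_def by (rule less_power_3)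
  define n where "n = (if even (3 ^ m + L + 1 + c) then 3 ^ m + L + 1 else 3 ^ m + L + 2)"
  have n: "3 ^ m + L < n" "n \<le> 3 ^ m + L + 2" "even (n + c)"
    by (auto simp: n_def)
  have "n \<in> hitting_times shift {x} {y \<in> spacing_shift spacings. y 0 \<noteq> 0}"
    using n m by (intro Lc[of m]) auto
  moreover have "n + 2 \<in> hitting_times shift {x} {y \<in> spacing_shift spacings. y 0 \<noteq> 0}"
    using n m by (intro Lc[of m]) auto
  ultimately have "x n \<noteq> 0" "x (n + 2) \<noteq> 0"
    by (auto simp: hitting_times_def funpow_shift simp del: funpow.simps add_2_eq_Suc')
  then have "n + 2 - n \<in> spacings"
    using spacing_shiftD[OF x, of n "n + 2"] by simp
  then have "(2::nat) + 3 ^ 0 \<noteq> 3 ^ 1"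
    unfolding spacings_def by (metis (mono_tags, lifting) add_diff_cancel_left' mem_Collect_eq)
  then show False
    by simp
qed

lemma dynamical_system_spacing_shift: "dynamical_system (spacing_metric spacings) shift"
proof -
  have "continuous_map (top_of_set (spacing_shift spacings)) (top_of_set (spacing_shift spacings)) shift"
    using continuous_on_shift shift_image_spacing_shift[of spacings]
    by (auto simp: continuous_map_in_subtopology)
  moreover have "compact_space (top_of_set (spacing_shift spacings))"
    by (intro compact_space_subtopology) (simp add: compact_spacing_shift)
  moreover have "\<nexists>x. spacing_shift spacings = {x}"
  proof
    assume "\<exists>x. spacing_shift spacings = {x}"
    then obtain x where x: "spacing_shift spacings = {x}" ..
    have "x = (\<lambda>_. 0)"
      using zero_in_spacing_shift[of spacings] unfolding x by (rule singletonD[symmetric])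
    moreover have "x = (\<lambda>k. if k = 0 then 1 else 0)"
      using single_one_in_spacing_shift[of 0 spacings] unfolding x by (rule singletonD[symmetric])
    ultimately have "(\<lambda>_::nat. 0) = (\<lambda>k. if k = 0 then 1 else 0 :: real)"
      by (rule trans[OF sym])
    from fun_cong[OF this, of 0] show False
      by simp
  qed
  moreover have "spacing_shift spacings \<noteq> {}"
    using zero_in_spacing_shift[of spacings] by (metis empty_iff)
  ultimately show ?thesis
    unfolding dynamical_system_def mspace_spacing_metric mtopology_spacing_metric
    by (intro conjI ballI shift_image_spacing_shift spacing_shift_no_isolated_points)
qed

lemma transitive_compact_spacing_shift: "transitive_compact (spacing_metric spacings) shift"
  unfolding transitive_compact_def
proof (intro ballI bexI[of _ "\<lambda>_. 0"] allI impI)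
  show "(\<lambda>_. 0) \<in> mspace (spacing_metric spacings)"
    by (simp add: zero_in_spacing_shift)
  fix x G U V
  assume "x \<in> mspace (spacing_metric spacings)"
    and G: "neighborhood_of (spacing_metric spacings) (\<lambda>_. 0) G"
    and U: "opene (spacing_metric spacings) U" and V: "opene (spacing_metric spacings) V"
  then have x: "x \<in> spacing_shift spacings"
    by simp
  obtain W where W: "openin (top_of_set (spacing_shift spacings)) W" "(\<lambda>_. 0) \<in> W" "W \<subseteq> G"
    using G by (auto simp: neighborhood_of_def)
  obtain k where k: "\<And>y. \<lbrakk>y \<in> spacing_shift spacings; \<And>i. i < k \<Longrightarrow> y i = 0\<rbrakk> \<Longrightarrow> y \<in> W"
    using open_contains_cylinder[OF W(1,2)] by blast
  obtain L c where Lc: "\<And>m n. \<lbrakk>3 ^ m + L < n; n + L \<le> 2 * 3 ^ m; even (n + c)\<rbrakk>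
      \<Longrightarrow> n \<in> hitting_times shift U V"
    using hitting_times_in_long_intervals[OF U V] by blast
  \<comment> \<open>The exponent is chosen so large that the interval behind \<open>3 ^ m\<close> has room for all the
    windows of \<open>zero_block\<close> and for the margin \<open>L\<close> on either side.\<close>
  define m where "m = 2 * L + 2 + 3 ^ (k + 1)"
  have m: "2 * L + 2 + 3 ^ (k + 1) < 3 ^ m"
    unfolding m_def by (rule less_power_3)
  \<comment> \<open>A block of length \<open>k + 1\<close> gives two consecutive visits to \<open>W\<close>, one of each parity.\<close>
  obtain i where i: "i \<le> k + 1" "\<And>p. p < k + 1 \<Longrightarrow> x (3 ^ m + L + 1 + 3 ^ i + p) = 0"
    using zero_block[OF x] by blast
  define s where "s = 3 ^ m + L + 1 + 3 ^ i"
  have s: "\<And>p. p < k + 1 \<Longrightarrow> x (s + p) = 0"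
    using i(2) by (simp add: s_def)
  have "(3::nat) ^ i \<le> 3 ^ (k + 1)"
    using i(1) by (intro power_increasing) simp_all
  then have s_bounds: "3 ^ m + L < s" "s + 1 + L \<le> 2 * 3 ^ m"
    using m unfolding s_def by linarith+
  define n where "n = (if even (s + c) then s else s + 1)"
  have n: "n = s \<or> n = s + 1" "even (n + c)"
    by (auto simp: n_def)
  have "x (n + p) = 0" if "p < k" for p
    using n(1) s[of p] s[of "p + 1"] that by auto
  then have "(shift ^^ n) x \<in> W"
    using funpow_shift_in_spacing_shift[OF x] by (intro k) (simp_all add: funpow_shift)
  then have "n \<in> visiting_times shift x G"
    using W(3) by (auto simp: visiting_times_def)
  moreover have "n \<in> hitting_times shift U V"
    using n s_bounds by (intro Lc[of m]) auto
  ultimately show "visiting_times shift x G \<inter> hitting_times shift U V \<noteq> {}"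
    by blast
qed

lemma square_not_transitive: "\<not> transitive_system (spacing_metric spacings) (shift ^^ 2)"
proof
  assume trans: "transitive_system (spacing_metric spacings) (shift ^^ 2)"
  have "opene (spacing_metric spacings) {x \<in> spacing_shift spacings. x n \<noteq> 0}" for n
    using openin_nonzero_coordinate single_one_in_spacing_shift[of n spacings]
    by (auto simp: opene_def)
  then have "hitting_times (shift ^^ 2) {x \<in> spacing_shift spacings. x 0 \<noteq> 0}
      {x \<in> spacing_shift spacings. x 1 \<noteq> 0} \<noteq> {}"
    using trans unfolding transitive_system_def by blast
  then obtain n x where x: "x \<in> spacing_shift spacings" "x 0 \<noteq> 0"
      and "((shift ^^ 2) ^^ n) x 1 \<noteq> 0"
    by (auto simp: hitting_times_def)
  then have "x (2 * n + 1) \<noteq> 0"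
    by (simp only: funpow_mult funpow_shift not_False_eq_True)
  then have "2 * n + 1 - 0 \<in> spacings"
    using x(2) spacing_shiftD[OF x(1), of 0 "2 * n + 1"] by simp
  then show False
    by (simp add: spacings_def)
qed

theorem theorem3p14:
  shows "\<exists>(m :: point metric) (T :: point \<Rightarrow> point).
    dynamical_system m T \<and> transitive_compact m T \<and> \<not> totally_transitive m T"
proof -
  have "\<not> totally_transitive (spacing_metric spacings) shift"
    using square_not_transitive unfolding totally_transitive_def
    by (meson one_le_numeral)
  then show ?thesis
    using dynamical_system_spacing_shift transitive_compact_spacing_shift by blast
qed

end
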